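(* Let $\boldsymbol{X}_1,\dots,\boldsymbol{X}_n$ be i.i.d. from a distribution $G$ with density $g$ (not necessarily in the model), and let $\widehat{\boldsymbol{\theta}}_{\beta,g}=\boldsymbol{T}_\beta(G_n)$ be the minimum density power divergence estimator with tuning parameter $\beta$, $G_n$ being the empirical distribution. Under the null hypothesis $H_0:\boldsymbol{T}_\beta(G)=\boldsymbol{\theta}_0$, $$W_n^0(\widehat{\boldsymbol{\theta}}_{\beta,g})=n(\widehat{\boldsymbol{\theta}}_{\beta,g}-\boldsymbol{\theta}_0)^T\boldsymbol{\Sigma}_\beta^{-1}(\boldsymbol{\theta}_0)(\widehat{\boldsymbol{\theta}}_{\beta,g}-\boldsymbol{\theta}_0)\ \underset{n\to\infty}{\overset{\mathcal{L}}{\longrightarrow}}\ \sum_{i=1}^pc_{i,\beta,g}(\boldsymbol{\theta}_0)Z_i^2,$$ where $\{Z_i\}_{i=1}^p$ are i.i.d. standard normal random variables and $\{c_{i,\beta,g}(\boldsymbol{\theta}_0)\}_{i=1}^p$ is the set of eigenvalues of $\boldsymbol{\Sigma}_\beta^{-1}(\boldsymbol{\theta}_0)\boldsymbol{\Sigma}_{\beta,g}(\boldsymbol{\theta}_0)$.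
   Context: $\{f_{\boldsymbol{\theta}}:\boldsymbol{\theta}\in\Theta\subset\mathbb{R}^p\}$ is a parametric family of densities with respect to a dominating measure, written $d\boldsymbol{x}$; $\beta\ge0$. Put $\boldsymbol{u}_{\boldsymbol{\theta}}(\boldsymbol{x})=\frac{\partial}{\partial\boldsymbol{\theta}}\log f_{\boldsymbol{\theta}}(\boldsymbol{x})$, $\boldsymbol{I}_{\boldsymbol{\theta}}(\boldsymbol{x})=-\frac{\partial}{\partial\boldsymbol{\theta}}\boldsymbol{u}_{\boldsymbol{\theta}}^T(\boldsymbol{x})$, $\boldsymbol{\xi}_\beta(\boldsymbol{\theta})=\int\boldsymbol{u}_{\boldsymbol{\theta}}f_{\boldsymbol{\theta}}^{1+\beta}d\boldsymbol{x}$, $\boldsymbol{J}_\beta(\boldsymbol{\theta})=\int\boldsymbol{u}_{\boldsymbol{\theta}}\boldsymbol{u}_{\boldsymbol{\theta}}^Tf_{\boldsymbol{\theta}}^{1+\beta}d\boldsymbol{x}$, $\boldsymbol{K}_\beta(\boldsymbol{\theta})=\int\boldsymbol{u}_{\boldsymbol{\theta}}\boldsymbol{u}_{\boldsymbol{\theta}}^Tf_{\boldsymbol{\theta}}^{1+2\beta}d\boldsymbol{x}-\boldsymbol{\xi}_\beta\boldsymbol{\xi}_\beta^T$, $\boldsymbol{\Sigma}_\beta=\boldsymbol{J}_\beta^{-1}\boldsymbol{K}_\beta\boldsymbol{J}_\beta^{-1}$ (invertible at $\boldsymbol{\theta}_0$), and $$\boldsymbol{J}_{\beta,g}(\boldsymbol{\theta})=\int\boldsymbol{u}_{\boldsymbol{\theta}}\boldsymbol{u}_{\boldsymbol{\theta}}^Tf_{\boldsymbol{\theta}}^{1+\beta}d\boldsymbol{x}+\int(\boldsymbol{I}_{\boldsymbol{\theta}}-\beta\boldsymbol{u}_{\boldsymbol{\theta}}\boldsymbol{u}_{\boldsymbol{\theta}}^T)(g-f_{\boldsymbol{\theta}})f_{\boldsymbol{\theta}}^\beta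 d\boldsymbol{x},$$ $$\boldsymbol{\xi}_{\beta,g}(\boldsymbol{\theta})=\int\boldsymbol{u}_{\boldsymbol{\theta}}f_{\boldsymbol{\theta}}^\beta g\,d\boldsymbol{x},\qquad\boldsymbol{K}_{\beta,g}(\boldsymbol{\theta})=\int\boldsymbol{u}_{\boldsymbol{\theta}}\boldsymbol{u}_{\boldsymbol{\theta}}^Tf_{\boldsymbol{\theta}}^{2\beta}g\,d\boldsymbol{x}-\boldsymbol{\xi}_{\beta,g}\boldsymbol{\xi}_{\beta,g}^T,\qquad\boldsymbol{\Sigma}_{\beta,g}=\boldsymbol{J}_{\beta,g}^{-1}\boldsymbol{K}_{\beta,g}\boldsymbol{J}_{\beta,g}^{-1}.$$ $\boldsymbol{T}_\beta(G)$ is the minimizer over $\boldsymbol{\theta}\in\Theta$ of $\int f_{\boldsymbol{\theta}}^{1+\beta}d\boldsymbol{x}-(1+\frac1\beta)\int f_{\boldsymbol{\theta}}^\beta dG$ if $\beta>0$, and of $-\int\log f_{\boldsymbol{\theta}}\,dG$ if $\beta=0$. Standing fact from the literature, assumed throughout: when $\boldsymbol{T}_\beta(G)=\boldsymbol{\theta}_0$, $n^{1/2}(\widehat{\boldsymbol{\theta}}_{\beta,g}-\boldsymbol{\theta}_0)\overset{\mathcal{L}}{\longrightarrow}\mathcal{N}(\boldsymbol{0}_p,\boldsymbol{\Sigma}_{\beta,g}(\boldsymbol{\theta}_0))$ as $n\to\infty$. *)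

theory Defs
  imports "HOL-Probability.Probability" "HOL-Computational_Algebra.Polynomial"
begin

definition partial_deriv :: "'p \<Rightarrow> (real ^ 'p \<Rightarrow> real) \<Rightarrow> real ^ 'p \<Rightarrow> real" where
  "partial_deriv i h \<theta> = deriv (\<lambda>t. h (\<theta> + t *\<^sub>R axis i 1)) 0"

definition score :: "(real ^ 'p \<Rightarrow> 'x \<Rightarrow> real) \<Rightarrow> real ^ 'p \<Rightarrow> 'x \<Rightarrow> real ^ 'p" where
  "score f \<theta> x = (\<chi> i. partial_deriv i (\<lambda>\<eta>. ln (f \<eta> x)) \<theta>)"

definition info :: "(real ^ 'p \<Rightarrow> 'x \<Rightarrow> real) \<Rightarrow> real ^ 'p \<Rightarrow> 'x \<Rightarrow> real ^ 'p ^ 'p" where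
  "info f \<theta> x = (\<chi> i j. - partial_deriv i (\<lambda>\<eta>. score f \<eta> x $ j) \<theta>)"

definition outer :: "real ^ 'p \<Rightarrow> real ^ 'p ^ 'p" where
  "outer v = (\<chi> i j. v $ i * v $ j)"

text \<open>
  Since \<open>0 powr b = 0\<close> for every \<open>b\<close> (also \<open>b = 0\<close>), every integrand below
  vanishes where \<open>f \<theta>\<close> does; the score is not defined at such points.
\<close>

definition xi :: "'x measure \<Rightarrow> (real ^ 'p \<Rightarrow> 'x \<Rightarrow> real) \<Rightarrow> real \<Rightarrow> real ^ 'p \<Rightarrow> real ^ 'p" where
  "xi \<mu> f \<beta> \<theta> = (\<integral>x. (f \<theta> x powr (1 + \<beta>)) *\<^sub>R score f \<theta> x \<partial>\<mu>)"

definition J_mat :: "'x measure \<Rightarrow> (real ^ 'p \<Rightarrow> 'x \<Rightarrow> real) \<Rightarrow> real \<Rightarrow> real ^ 'p \<Rightarrow> real ^ 'p ^ 'p" where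
  "J_mat \<mu> f \<beta> \<theta> = (\<integral>x. (f \<theta> x powr (1 + \<beta>)) *\<^sub>R outer (score f \<theta> x) \<partial>\<mu>)"

definition K_mat :: "'x measure \<Rightarrow> (real ^ 'p \<Rightarrow> 'x \<Rightarrow> real) \<Rightarrow> real \<Rightarrow> real ^ 'p \<Rightarrow> real ^ 'p ^ 'p" where
  "K_mat \<mu> f \<beta> \<theta> =
     (\<integral>x. (f \<theta> x powr (1 + 2 * \<beta>)) *\<^sub>R outer (score f \<theta> x) \<partial>\<mu>) - outer (xi \<mu> f \<beta> \<theta>)"

definition Sigma_mat :: "'x measure \<Rightarrow> (real ^ 'p \<Rightarrow> 'x \<Rightarrow> real) \<Rightarrow> real \<Rightarrow> real ^ 'p \<Rightarrow> real ^ 'p ^ 'p" where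
  "Sigma_mat \<mu> f \<beta> \<theta> =
     matrix_inv (J_mat \<mu> f \<beta> \<theta>) ** K_mat \<mu> f \<beta> \<theta> ** matrix_inv (J_mat \<mu> f \<beta> \<theta>)"

definition xi_g ::
  "'x measure \<Rightarrow> (real ^ 'p \<Rightarrow> 'x \<Rightarrow> real) \<Rightarrow> ('x \<Rightarrow> real) \<Rightarrow> real \<Rightarrow> real ^ 'p \<Rightarrow> real ^ 'p" where
  "xi_g \<mu> f g \<beta> \<theta> = (\<integral>x. (f \<theta> x powr \<beta> * g x) *\<^sub>R score f \<theta> x \<partial>\<mu>)"

definition J_mat_g ::
  "'x measure \<Rightarrow> (real ^ 'p \<Rightarrow> 'x \<Rightarrow> real) \<Rightarrow> ('x \<Rightarrow> real) \<Rightarrow> real \<Rightarrow> real ^ 'p \<Rightarrow> real ^ 'p ^ 'p" where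
  "J_mat_g \<mu> f g \<beta> \<theta> =
     (\<integral>x. (f \<theta> x powr (1 + \<beta>)) *\<^sub>R outer (score f \<theta> x) \<partial>\<mu>) +
     (\<integral>x. ((g x - f \<theta> x) * f \<theta> x powr \<beta>) *\<^sub>R
            (info f \<theta> x - \<beta> *\<^sub>R outer (score f \<theta> x)) \<partial>\<mu>)"

definition K_mat_g ::
  "'x measure \<Rightarrow> (real ^ 'p \<Rightarrow> 'x \<Rightarrow> real) \<Rightarrow> ('x \<Rightarrow> real) \<Rightarrow> real \<Rightarrow> real ^ 'p \<Rightarrow> real ^ 'p ^ 'p" where
  "K_mat_g \<mu> f g \<beta> \<theta> =
     (\<integral>x. (f \<theta> x powr (2 * \<beta>) * g x) *\<^sub>R outer (score f \<theta> x) \<partial>\<mu>) - outer (xi_g \<mu> f g \<beta> \<theta>)"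

definition Sigma_mat_g ::
  "'x measure \<Rightarrow> (real ^ 'p \<Rightarrow> 'x \<Rightarrow> real) \<Rightarrow> ('x \<Rightarrow> real) \<Rightarrow> real \<Rightarrow> real ^ 'p \<Rightarrow> real ^ 'p ^ 'p" where
  "Sigma_mat_g \<mu> f g \<beta> \<theta> =
     matrix_inv (J_mat_g \<mu> f g \<beta> \<theta>) ** K_mat_g \<mu> f g \<beta> \<theta> ** matrix_inv (J_mat_g \<mu> f g \<beta> \<theta>)"

definition is_density :: "'x measure \<Rightarrow> ('x \<Rightarrow> real) \<Rightarrow> bool" where
  "is_density \<mu> h \<longleftrightarrow> h \<in> borel_measurable \<mu> \<and> (\<forall>x\<in>space \<mu>. 0 \<le> h x) \<and>
     (\<integral>\<^sup>+x. ennreal (h x) \<partial>\<mu>) = 1"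

text \<open>
  The objective takes values in the extended reals.  For \<open>\<beta> = 0\<close> it is
  \<open>\<integral> - log f\<^sub>\<theta> dG\<close>, split into the integrals of the negative and the positive part
  of \<open>log f\<^sub>\<theta>\<close> (\<open>ennreal\<close> truncates negative reals to 0), with \<open>log 0 = -\<infinity>\<close>.
  The subtraction satisfies \<open>\<infinity> - \<infinity> = \<infinity>\<close>, so
  an undefined objective is never smaller than a defined one.
\<close>

definition dpd_objective ::
  "'x measure \<Rightarrow> (real ^ 'p \<Rightarrow> 'x \<Rightarrow> real) \<Rightarrow> real \<Rightarrow> 'x measure \<Rightarrow> real ^ 'p \<Rightarrow> ereal" where
  "dpd_objective \<mu> f \<beta> G \<theta> =
     (if \<beta> = 0 then
        enn2ereal (\<integral>\<^sup>+x. (if f \<theta> x = 0 then \<infinity> else ennreal (- ln (f \<theta> x))) \<partial>G)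
        - enn2ereal (\<integral>\<^sup>+x. ennreal (ln (f \<theta> x)) \<partial>G)
      else
        enn2ereal (\<integral>\<^sup>+x. ennreal (f \<theta> x powr (1 + \<beta>)) \<partial>\<mu>)
        - ereal (1 + 1 / \<beta>) * enn2ereal (\<integral>\<^sup>+x. ennreal (f \<theta> x powr \<beta>) \<partial>G))"

text \<open>
  The functional \<open>T\<^sub>\<beta>(G)\<close> as the set of minimizers over \<open>\<Theta>\<close>: the equation
  \<open>T\<^sub>\<beta>(G) = \<theta>\<^sub>0\<close> reads \<open>mdpd_functional \<mu> f \<Theta> \<beta> G = {\<theta>\<^sub>0}\<close>.
\<close>

definition mdpd_functional ::
  "'x measure \<Rightarrow> (real ^ 'p \<Rightarrow> 'x \<Rightarrow> real) \<Rightarrow> (real ^ 'p) set \<Rightarrow> real \<Rightarrow> 'x measure \<Rightarrow> (real ^ 'p) set" where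
  "mdpd_functional \<mu> f \<Theta> \<beta> G = {\<theta>. is_arg_min (dpd_objective \<mu> f \<beta> G) (\<lambda>\<theta>. \<theta> \<in> \<Theta>) \<theta>}"

definition empirical :: "'x measure \<Rightarrow> (nat \<Rightarrow> 'w \<Rightarrow> 'x) \<Rightarrow> nat \<Rightarrow> 'w \<Rightarrow> 'x measure" where
  "empirical \<mu> X n \<omega> = distr (uniform_count_measure {..<n}) \<mu> (\<lambda>i. X i \<omega>)"

text \<open>
  An estimator is \<open>T\<^sub>\<beta>(G\<^sub>n)\<close> wherever the latter exists: it is a random vector
  that minimizes the empirical objective for every sample for which a minimizer exists.
  (For small \<open>n\<close> there may be none, e.g. for the normal model with \<open>n = 1\<close> and \<open>\<beta> = 0\<close>.)
\<close>

definition is_mdpd_estimator ::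
  "'x measure \<Rightarrow> (real ^ 'p \<Rightarrow> 'x \<Rightarrow> real) \<Rightarrow> (real ^ 'p) set \<Rightarrow> real \<Rightarrow> 'w measure \<Rightarrow>
   (nat \<Rightarrow> 'w \<Rightarrow> 'x) \<Rightarrow> (nat \<Rightarrow> 'w \<Rightarrow> real ^ 'p) \<Rightarrow> bool" where
  "is_mdpd_estimator \<mu> f \<Theta> \<beta> M X \<theta>hat \<longleftrightarrow>
     (\<forall>n>0. \<theta>hat n \<in> borel_measurable M \<and>
       (\<forall>\<omega>\<in>space M. mdpd_functional \<mu> f \<Theta> \<beta> (empirical \<mu> X n \<omega>) \<noteq> {} \<longrightarrow>
          \<theta>hat n \<omega> \<in> mdpd_functional \<mu> f \<Theta> \<beta> (empirical \<mu> X n \<omega>)))"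

definition weak_conv_vec :: "(nat \<Rightarrow> (real ^ 'p) measure) \<Rightarrow> (real ^ 'p) measure \<Rightarrow> bool" where
  "weak_conv_vec N_seq N \<longleftrightarrow>
     (\<forall>h :: real ^ 'p \<Rightarrow> real. continuous_on UNIV h \<longrightarrow> bounded (range h) \<longrightarrow>
        (\<lambda>n. \<integral>x. h x \<partial>N_seq n) \<longlonglongrightarrow> (\<integral>x. h x \<partial>N))"

definition std_normal_vec :: "(real ^ 'p) measure" where
  "std_normal_vec =
     distr (Pi\<^sub>M UNIV (\<lambda>_. density lborel (\<lambda>t. ennreal (std_normal_density t)))) borel (\<lambda>z. \<chi> i. z i)"

text \<open>
  \<open>N(m, S)\<close> is the law of \<open>m + B Z\<close> with \<open>Z\<close> standard normal and \<open>B B\<^sup>T = S\<close>;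
  \<open>S\<close> may be singular.
\<close>

definition multivariate_normal :: "real ^ 'p \<Rightarrow> real ^ 'p ^ 'p \<Rightarrow> (real ^ 'p) measure \<Rightarrow> bool" where
  "multivariate_normal m S N \<longleftrightarrow>
     (\<exists>B :: real ^ 'p ^ 'p. B ** transpose B = S \<and>
        N = distr std_normal_vec borel (\<lambda>z. m + B *v z))"

definition charpoly :: "real ^ 'p ^ 'p \<Rightarrow> real poly" where
  "charpoly A = det (\<chi> i j. (if i = j then [:0, 1:] else 0) - [:A $ i $ j:])"

text \<open>\<open>c\<close> lists the eigenvalues of \<open>A\<close>, all of them real, with algebraic multiplicity.\<close>

definition lists_eigenvalues :: "('p \<Rightarrow> real) \<Rightarrow> real ^ 'p ^ 'p \<Rightarrow> bool" where
  "lists_eigenvalues c A \<longleftrightarrow> charpoly A = (\<Prod>i\<in>UNIV. [:- c i, 1:])"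

end

theory Submission
  imports Defs
begin

text \<open>
  Write \<open>Q\<close> for the inverse of \<open>\<Sigma>\<^sub>\<beta>(\<theta>\<^sub>0)\<close> and \<open>Y\<^sub>n\<close> for the scaled error
  \<open>\<surd>n (\<theta>hat\<^sub>n - \<theta>\<^sub>0)\<close>, so that the test statistic is the quadratic form
  \<open>Y\<^sub>n\<^sup>T Q Y\<^sub>n\<close>.  The standing fact says that \<open>Y\<^sub>n\<close> converges weakly to \<open>B z\<close>, where
  \<open>z\<close> is a standard normal vector and \<open>B B\<^sup>T = \<Sigma>\<^sub>\<beta>\<^sub>,\<^sub>g(\<theta>\<^sub>0)\<close>.  A quadratic form is continuous, so
  the statistic converges weakly to \<open>z\<^sup>T C z\<close> with \<open>C = B\<^sup>T Q B\<close>
  (\<open>weak_conv_vec_continuous_mapping\<close>).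

  The matrix \<open>Q\<close> is symmetric, because it is built from integrals of outer products
  \<open>u u\<^sup>T\<close>; hence \<open>C\<close> is symmetric and \<open>C = U D U\<^sup>T\<close> with \<open>U\<close> orthogonal and \<open>D\<close> diagonal.
  The law of \<open>z\<close> is invariant under \<open>U\<close> (\<open>std_normal_vec_rotation_invariant\<close>), so
  \<open>z\<^sup>T C z\<close> has the law of \<open>z\<^sup>T D z\<close>, which is a sum of squares of independent standard normal
  variables weighted by the eigenvalues of \<open>C\<close> (\<open>distr_quadratic_form_std_normal_vec\<close>).

  It remains to see that \<open>C = B\<^sup>T (Q B)\<close> and \<open>A = (Q B) B\<^sup>T\<close> have the same eigenvalues.
  Characteristic polynomials of \<open>S T\<close> and \<open>T S\<close> agree for all square matrices
  (\<open>charpoly_matrix_mult_commute\<close>); this covers singular \<open>B\<close> as well, and it shows in particular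
  that \<open>A\<close>, in general not symmetric, has only real eigenvalues.  A list of
  eigenvalues is determined by the characteristic polynomial up to order, and permuting the columns of
  \<open>U\<close> realises any given order (\<open>diagonalise_with_listed_eigenvalues\<close>).
\<close>

section \<open>Orthonormal eigenbases of self-adjoint maps\<close>

text \<open>
  The quadratic form \<open>x \<bullet> f x\<close> attains its maximum \<open>l\<close> on the compact unit sphere of \<open>S\<close>.  At a
  maximiser \<open>v\<close> the form \<open>l (x \<bullet> x) - x \<bullet> f x \<ge> 0\<close> vanishes, so its first-order variation in the
  direction \<open>w = f v - l v\<close> must vanish too; that variation is a multiple of \<open>w \<bullet> w\<close>.
\<close>

lemma self_adjoint_has_unit_eigenvector:
  fixes f :: "'a::euclidean_space \<Rightarrow> 'a"
  assumes lin: "linear f" and adj: "\<And>x y. f x \<bullet> y = x \<bullet> f y"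
    and S: "subspace S" "S \<noteq> {0}" and inv: "f ` S \<subseteq> S"
  obtains v l where "v \<in> S" "norm v = 1" "f v = l *\<^sub>R v"
proof -
  obtain z where z: "z \<in> S" "z \<noteq> 0"
    using S subspace_0 by blast
  have "compact (S \<inter> sphere 0 1)"
    using closed_subspace[OF S(1)] by (simp add: closed_Int_compact)
  moreover have "z /\<^sub>R norm z \<in> S \<inter> sphere 0 1"
    using z S(1) by (simp add: subspace_scale)
  then have "S \<inter> sphere 0 1 \<noteq> {}" by blast
  moreover have "continuous_on (S \<inter> sphere 0 1) (\<lambda>x. x \<bullet> f x)"
    by (intro continuous_intros linear_continuous_on lin linear_conv_bounded_linear[THEN iffD1])
  ultimately have "\<exists>v\<in>S \<inter> sphere 0 1. \<forall>x\<in>S \<inter> sphere 0 1. x \<bullet> f x \<le> v \<bullet> f v"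
    by (intro continuous_attains_sup)
  then obtain v where "v \<in> S \<inter> sphere 0 1"
    and "\<forall>x\<in>S \<inter> sphere 0 1. x \<bullet> f x \<le> v \<bullet> f v" ..
  then have v: "v \<in> S" "norm v = 1"
    and vmax: "\<And>x. x \<in> S \<Longrightarrow> norm x = 1 \<Longrightarrow> x \<bullet> f x \<le> v \<bullet> f v"
    by auto
  define l where "l = v \<bullet> f v"
  have le: "x \<bullet> f x \<le> l * (x \<bullet> x)" if x: "x \<in> S" for x
  proof (cases "x = 0")
    case False
    have "(x /\<^sub>R norm x) \<bullet> f (x /\<^sub>R norm x) \<le> l"
      unfolding l_def by (rule vmax) (use x False S(1) in \<open>auto simp: subspace_scale\<close>)
    then have "(x \<bullet> f x) / (norm x * norm x) \<le> l"
      by (simp add: linear_cmul[OF lin] field_simps)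
    then show ?thesis
      using False by (simp add: field_simps dot_square_norm power2_eq_square)
  qed (simp add: linear_0[OF lin])
  define w where "w = f v - l *\<^sub>R v"
  have wS: "w \<in> S"
    unfolding w_def using v inv S(1) by (auto intro!: subspace_diff subspace_scale)
  define b where "b = l * (w \<bullet> w) - w \<bullet> f w"
  \<comment> \<open>Maximality at \<open>v + t w\<close>: the term linear in \<open>t\<close> is bounded by a multiple of \<open>t\<^sup>2\<close>.\<close>
  have quad: "2 * t * (w \<bullet> w) \<le> t\<^sup>2 * b" for t
  proof -
    have "(v + t *\<^sub>R w) \<bullet> f (v + t *\<^sub>R w) \<le> l * ((v + t *\<^sub>R w) \<bullet> (v + t *\<^sub>R w))"
      by (rule le) (use v wS S(1) in \<open>auto intro!: subspace_add subspace_scale\<close>)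
    moreover have wfv: "w \<bullet> f v = w \<bullet> w + l * (v \<bullet> w)"
      by (subst (2) w_def) (simp add: inner_diff_right inner_commute)
    moreover have "v \<bullet> f w = w \<bullet> w + l * (v \<bullet> w)"
      by (metis adj inner_commute wfv)
    moreover have "v \<bullet> v = 1"
      using v by (simp add: dot_square_norm)
    ultimately show ?thesis
      unfolding b_def by (simp add: linear_add[OF lin] linear_cmul[OF lin] inner_add_left
          inner_add_right l_def[symmetric] inner_commute[of w v]) (simp add: algebra_simps power2_eq_square)
  qed
  have "w \<bullet> w \<le> 0"
  proof (cases "b \<le> 0")
    case True
    then show ?thesis using quad[of 1] by simp
  next
    case False
    then show ?thesis
      \<comment> \<open>This \<open>t\<close> minimises \<open>t\<^sup>2 b - 2 t (w \<bullet> w)\<close>; the minimum \<open>- (w \<bullet> w)\<^sup>2 / b\<close> must not be negative.\<close>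
      using quad[of "(w \<bullet> w) / b"] by (simp add: power2_eq_square field_simps)
         (smt (verit) inner_ge_zero mult_nonneg_nonneg mult_pos_pos)
  qed
  then have "w = 0"
    by (metis inner_gt_zero_iff not_le)
  then have "f v = l *\<^sub>R v"
    by (simp add: w_def)
  with v show ?thesis by (rule that)
qed

text \<open>
  Induction on the dimension: a self-adjoint map that preserves \<open>S\<close> also preserves the orthogonal
  complement within \<open>S\<close> of any eigenvector.
\<close>

lemma self_adjoint_orthonormal_eigenbasis:
  fixes f :: "'a::euclidean_space \<Rightarrow> 'a"
  assumes lin: "linear f" and adj: "\<And>x y. f x \<bullet> y = x \<bullet> f y"
    and "subspace S" and "f ` S \<subseteq> S"
  shows "\<exists>B. B \<subseteq> S \<and> pairwise orthogonal B \<and> span B = S \<and>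
    (\<forall>b\<in>B. norm b = 1 \<and> (\<exists>l. f b = l *\<^sub>R b))"
  using assms(3,4)
proof (induction "dim S" arbitrary: S rule: less_induct)
  case less
  note S = less.prems
  show ?case
  proof (cases "S = {0}")
    case True
    then show ?thesis by (intro exI[of _ "{}"]) auto
  next
    case False
    obtain v l where v: "v \<in> S" "norm v = 1" "f v = l *\<^sub>R v"
      using self_adjoint_has_unit_eigenvector[OF lin adj S(1) False S(2)] by blast
    define T where "T = S \<inter> {x. v \<bullet> x = 0}"
    have T: "subspace T"
      unfolding T_def using S(1) subspace_hyperplane by (rule subspace_inter)
    have fT: "f ` T \<subseteq> T"
    proof -
      have "v \<bullet> f x = l * (v \<bullet> x)" for x
        using adj[of v x] v(3) by simp
      then show ?thesis using S(2) unfolding T_def by auto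
    qed
    have "v \<notin> T"
      using v(2) unfolding T_def by auto
    moreover have "T \<subseteq> S" unfolding T_def by simp
    ultimately have "T \<subset> S" using v(1) by blast
    then have "dim T < dim S"
      by (intro dim_psubset) (simp add: span_eq_iff[THEN iffD2] T S(1))
    from less.hyps[OF this T fT] obtain B where B: "B \<subseteq> T" "pairwise orthogonal B" "span B = T"
      "\<forall>b\<in>B. norm b = 1 \<and> (\<exists>l. f b = l *\<^sub>R b)" by blast
    have "x \<in> span (insert v B)" if "x \<in> S" for x
    proof -
      have "x - (v \<bullet> x) *\<^sub>R v \<in> T"
        using that v S(1) unfolding T_def
        by (auto intro!: subspace_diff subspace_scale simp: inner_diff_right dot_square_norm)
      then show ?thesis using B(3) unfolding span_insert by blast
    qed
    moreover have "span (insert v B) \<subseteq> S"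
      by (rule span_minimal) (use v B(1) S(1) in \<open>auto simp: T_def\<close>)
    moreover have "pairwise orthogonal (insert v B)"
      using B(1,2) by (auto simp: pairwise_insert T_def orthogonal_def inner_commute)
    ultimately show ?thesis
      using B v by (intro exI[of _ "insert v B"]) (auto simp: T_def)
  qed
qed

lemma self_adjoint_orthonormal_eigenvectors_indexed:
  fixes f :: "real ^ 'n \<Rightarrow> real ^ 'n"
  assumes lin: "linear f" and adj: "\<And>x y. f x \<bullet> y = x \<bullet> f y"
  obtains b d where "\<And>i j. b i \<bullet> b j = (if i = j then 1 else 0)"
    and "\<And>i::'n. f (b i) = d i *\<^sub>R b i"
proof -
  obtain B where B: "pairwise orthogonal B" "span B = UNIV"
      "\<forall>b\<in>B. norm b = 1 \<and> (\<exists>l. f b = l *\<^sub>R b)"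
    using self_adjoint_orthonormal_eigenbasis[OF lin adj subspace_UNIV] by auto
  have ind: "independent B"
    by (rule pairwise_orthogonal_independent) (use B in auto)
  have "card B = CARD('n)"
    using dim_span_eq_card_independent[OF ind] B(2) by simp
  then obtain b where b: "bij_betw b (UNIV::'n set) B"
    by (metis finite_same_card_bij ind independent_imp_finite finite_code)
  have "\<forall>i. \<exists>l. f (b i) = l *\<^sub>R b i"
    using B(3) b by (auto simp: bij_betw_def)
  then obtain d where "\<And>i. f (b i) = d i *\<^sub>R b i" by metis
  moreover have "b i \<bullet> b j = (if i = j then 1 else 0)" for i j
  proof (cases "i = j")
    case True
    then show ?thesis using B(3) b by (auto simp: bij_betw_def dot_square_norm)
  next
    case False
    then have "b i \<noteq> b j" "b i \<in> B" "b j \<in> B"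
      using b by (auto simp: bij_betw_def inj_eq)
    then show ?thesis using B(1) False by (auto simp: pairwise_def orthogonal_def)
  qed
  ultimately show ?thesis using that by blast
qed

section \<open>Characteristic polynomials of products\<close>

lemma poly_charpoly: "poly (charpoly A) t = det (mat t - A)"
  by (simp add: charpoly_def det_def poly_sum poly_prod mat_def if_distrib[of "\<lambda>p. poly p t"] cong: if_cong)

lemma charpoly_eqI:
  assumes "\<And>t. det (mat t - A) = det (mat t - B)"
  shows "charpoly A = charpoly B"
  using assms by (simp add: poly_eq_poly_eq_iff[symmetric] fun_eq_iff poly_charpoly)

lemma mat_matrix_mult_commute: "mat t ** A = A ** (mat t :: real ^ 'n ^ 'n)"
  by (simp add: matrix_matrix_mult_def mat_def vec_eq_iff if_distrib[of "\<lambda>x. x * _"] if_distrib[of "\<lambda>x. _ * x"] cong: if_cong)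

lemma matrix_mult_diff_ldistrib:
  fixes A :: "real ^ 'n ^ 'm"
  shows "A ** (B - C) = A ** B - A ** C"
  by (simp add: matrix_matrix_mult_def vec_eq_iff right_diff_distrib sum_subtractf)

lemma matrix_mult_diff_rdistrib:
  fixes A :: "real ^ 'n ^ 'm"
  shows "(A - B) ** C = A ** C - B ** C"
  by (simp add: matrix_matrix_mult_def vec_eq_iff left_diff_distrib sum_subtractf)

text \<open>
  \<open>A\<close> and \<open>B\<close> are similar via \<open>S\<close>.  The intertwining form of the hypothesis avoids the inverse of \<open>S\<close>.
\<close>

lemma det_intertwined:
  fixes A B S :: "real ^ 'n ^ 'n"
  assumes "A ** S = S ** B" and "det S \<noteq> 0"
  shows "det (mat t - A) = det (mat t - B)"
proof -
  have "(mat t - A) ** S = S ** (mat t - B)"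
    using assms(1)
    by (simp add: matrix_mult_diff_ldistrib matrix_mult_diff_rdistrib mat_matrix_mult_commute)
  then have "det (mat t - A) * det S = det S * det (mat t - B)"
    by (metis det_mul)
  with assms(2) show ?thesis by simp
qed

text \<open>
  A number larger than the operator norm of \<open>A\<close> is not an eigenvalue.
\<close>

lemma charpoly_nonzero: "charpoly A \<noteq> 0"
proof
  assume *: "charpoly A = 0"
  define t where "t = onorm ((*v) A) + 1"
  have "x = 0" if "(mat t - A) *v x = 0" for x
  proof (rule ccontr)
    assume "x \<noteq> 0"
    have "mat t *v x = t *\<^sub>R x"
      by (simp add: matrix_vector_mult_def mat_def vec_eq_iff if_distrib[of "\<lambda>x. x * _"] cong: if_cong)
    then have "A *v x = t *\<^sub>R x"
      using that by (simp add: matrix_vector_mult_diff_rdistrib)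
    then have "\<bar>t\<bar> * norm x \<le> onorm ((*v) A) * norm x"
      using onorm[OF matrix_vector_mul_bounded_linear[of A], of x] by simp
    with \<open>x \<noteq> 0\<close> show False
      by (simp add: t_def)
  qed
  then have "invertible (mat t - A)"
    using matrix_left_invertible_ker[of "mat t - A"] by (auto simp: invertible_left_inverse)
  then have "poly (charpoly A) t \<noteq> 0"
    by (simp add: poly_charpoly invertible_det_nz)
  with * show False by simp
qed

lemma tendsto_det:
  fixes A :: "'a \<Rightarrow> real ^ 'n ^ 'n"
  assumes "\<And>i j. ((\<lambda>x. A x $ i $ j) \<longlongrightarrow> L $ i $ j) F"
  shows "((\<lambda>x. det (A x)) \<longlongrightarrow> det L) F"
  unfolding det_def by (intro tendsto_intros assms)

text \<open>
  If \<open>A\<close> is invertible, then \<open>A B\<close> and \<open>B A\<close> are similar.  In general \<open>A + s I\<close> is invertible for all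
  small \<open>s \<noteq> 0\<close>, and both determinants depend continuously on \<open>s\<close>.
\<close>

lemma charpoly_matrix_mult_commute:
  fixes A B :: "real ^ 'n ^ 'n"
  shows "charpoly (A ** B) = charpoly (B ** A)"
proof (rule charpoly_eqI)
  fix t
  define As where "As = (\<lambda>s. A + mat s)"
  have lim: "((\<lambda>s. As s $ i $ j) \<longlongrightarrow> A $ i $ j) (at 0)" for i j
    using tendsto_add[OF tendsto_const[of "A $ i $ j"] tendsto_ident_at[of "0::real" UNIV]]
    by (cases "i = j") (simp_all add: As_def mat_def)
  have lim_AB: "((\<lambda>s. det (mat t - As s ** B)) \<longlongrightarrow> det (mat t - A ** B)) (at 0)"
    by (rule tendsto_det) (auto simp: matrix_matrix_mult_def intro!: tendsto_intros lim)
  have lim_BA: "((\<lambda>s. det (mat t - B ** As s)) \<longlongrightarrow> det (mat t - B ** A)) (at 0)"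
    by (rule tendsto_det) (auto simp: matrix_matrix_mult_def intro!: tendsto_intros lim)
  have "eventually (\<lambda>s. det (mat t - As s ** B) = det (mat t - B ** As s)) (at 0)"
  proof -
    have "finite {s. poly (charpoly (- A)) s = 0}"
      by (rule poly_roots_finite) (rule charpoly_nonzero)
    then have "open (- ({s. poly (charpoly (- A)) s = 0} - {0}))"
      by (intro open_Compl finite_imp_closed) auto
    then have "eventually (\<lambda>s. s \<in> - ({s. poly (charpoly (- A)) s = 0} - {0})) (nhds 0)"
      by (rule eventually_nhds_in_open) auto
    then have "eventually (\<lambda>s. poly (charpoly (- A)) s \<noteq> 0) (at 0)"
      unfolding eventually_at_filter by (rule eventually_mono) auto
    then show ?thesis
    proof eventually_elim
      case (elim s)
      have "mat s - (- A) = As s"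
        by (simp add: As_def)
      with elim have "det (As s) \<noteq> 0"
        unfolding poly_charpoly by (simp only: simp_thms)
      then show ?case
        by (intro det_intertwined[where S = "As s"]) (simp add: matrix_mul_assoc)
    qed
  qed
  then have "((\<lambda>s. det (mat t - B ** As s)) \<longlongrightarrow> det (mat t - A ** B)) (at 0)"
    using lim_AB by (rule tendsto_cong[THEN iffD1])
  then show "det (mat t - A ** B) = det (mat t - B ** A)"
    using lim_BA by (rule tendsto_unique[OF trivial_limit_at])
qed

section \<open>Diagonalising with a prescribed list of eigenvalues\<close>

text \<open>
  Both families enumerate the multiset of roots of the same polynomial.
\<close>

lemma linear_factors_eq_imp_permutation:
  fixes c d :: "'n::finite \<Rightarrow> real"
  assumes "(\<Prod>i\<in>UNIV. [:- c i, 1:]) = (\<Prod>i\<in>UNIV. [:- d i, 1:])"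
  obtains p where "p permutes UNIV" "\<And>i. c i = d (p i)"
proof -
  have *: "proots (\<Prod>i\<in>UNIV. [:- c i, 1:]) = image_mset c (mset_set UNIV)" for c :: "'n \<Rightarrow> real"
  proof -
    have "(\<Sum>i\<in>I. {#c i#}) = image_mset c (mset_set I)" if "finite I" for I
      using that by induction auto
    moreover have "proots (\<Prod>i\<in>UNIV. [:- c i, 1:]) = (\<Sum>i\<in>UNIV. {#c i#})"
      by (subst proots_prod) simp_all
    ultimately show ?thesis by (metis finite)
  qed
  have "image_mset c (mset_set UNIV) = image_mset d (mset_set UNIV)"
    using arg_cong[OF assms, of proots] unfolding * .
  then show ?thesis
    using that by (rule image_mset_eq_implies_permutes[rotated]) auto
qed

lemma symmetric_matrix_self_adjoint:
  fixes C :: "real ^ 'n ^ 'n"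
  assumes "transpose C = C"
  shows "(C *v x) \<bullet> y = x \<bullet> (C *v y)"
  by (metis assms dot_lmul_matrix vector_transpose_matrix)

lemma det_diff_diagonal:
  "det (mat t - (\<chi> i j. if i = j then d i else 0)) = (\<Prod>i\<in>UNIV. t - d i)"
  by (subst det_diagonal) (auto simp: mat_def)

lemma symmetric_matrix_eigenbasis:
  fixes C :: "real ^ 'n ^ 'n"
  assumes "transpose C = C"
  obtains b d where "\<And>i j. b i \<bullet> b j = (if i = j then 1 else 0)"
    and "\<And>i. C *v b i = d i *\<^sub>R b i" and "lists_eigenvalues d C"
proof -
  obtain b d where b: "\<And>i j. b i \<bullet> b j = (if i = j then 1 else 0)"
    and d: "\<And>i::'n. C *v b i = d i *\<^sub>R b i"
    using self_adjoint_orthonormal_eigenvectors_indexed[OF matrix_vector_mul_linear[of C] symmetric_matrix_self_adjoint[OF assms]]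
    by blast
  define U where "U = (\<chi> i j. b j $ i)"
  define D :: "real^'n^'n" where "D = (\<chi> i j. if i = j then d i else 0)"
  have "orthogonal_matrix U"
    unfolding orthogonal_matrix U_def
    by (simp add: matrix_matrix_mult_def transpose_def mat_def vec_eq_iff b[unfolded inner_vec_def inner_real_def])
  then have "det U \<noteq> 0"
    using det_orthogonal_matrix by fastforce
  moreover have "C ** U = U ** D"
    using d by (simp add: matrix_matrix_mult_def matrix_vector_mult_def U_def D_def vec_eq_iff if_distrib[of "\<lambda>x. _ * x"] mult.commute cong: if_cong)
  ultimately have "det (mat t - C) = (\<Prod>i\<in>UNIV. t - d i)" for t
    using det_intertwined[of C U D t] by (simp add: D_def det_diff_diagonal)
  then have "lists_eigenvalues d C"
    unfolding lists_eigenvalues_def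
    by (simp add: poly_eq_poly_eq_iff[symmetric] fun_eq_iff poly_charpoly poly_prod)
  with b d show ?thesis by (rule that)
qed

text \<open>
  The order of the eigenvalues in \<open>c\<close> is prescribed, so the columns of \<open>U\<close> are an orthonormal eigenbasis
  permuted to match it.
\<close>

lemma diagonalise_with_listed_eigenvalues:
  fixes C :: "real ^ 'n ^ 'n"
  assumes sym: "transpose C = C" and c: "lists_eigenvalues c C"
  obtains U where "orthogonal_matrix U"
    and "\<And>y. (U *v y) \<bullet> (C *v (U *v y)) = (\<Sum>i\<in>UNIV. c i * (y $ i)\<^sup>2)"
proof -
  obtain b d where b: "\<And>i j. b i \<bullet> b j = (if i = j then 1 else 0)"
    and Cb: "\<And>i. C *v b i = d i *\<^sub>R b i" and d: "lists_eigenvalues d C"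
    using symmetric_matrix_eigenbasis[OF sym] by blast
  obtain p where p: "p permutes UNIV" "\<And>i. c i = d (p i)"
    using linear_factors_eq_imp_permutation[of c d] c d unfolding lists_eigenvalues_def by metis
  define U :: "real^'n^'n" where "U = (\<chi> i j. b (p j) $ i)"
  have b': "b (p i) \<bullet> b (p j) = (if i = j then 1 else 0)" for i j
    using permutes_inj[OF p(1)] by (simp add: b inj_eq)
  have "orthogonal_matrix U"
    unfolding orthogonal_matrix U_def
    by (simp add: matrix_matrix_mult_def transpose_def mat_def vec_eq_iff b'[unfolded inner_vec_def inner_real_def])
  moreover have "(U *v y) \<bullet> (C *v (U *v y)) = (\<Sum>i\<in>UNIV. c i * (y $ i)\<^sup>2)" for y
  proof -
    have U: "U *v y = (\<Sum>i\<in>UNIV. y $ i *\<^sub>R b (p i))"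
      by (simp add: U_def matrix_vector_mult_def vec_eq_iff sum_component mult.commute)
    have "C *v (U *v y) = (\<Sum>i\<in>UNIV. (c i * y $ i) *\<^sub>R b (p i))"
      unfolding U by (simp add: linear_sum[OF matrix_vector_mul_linear] matrix_vector_mult_scaleR Cb p(2) mult.commute)
    then show ?thesis
      unfolding U by (simp add: inner_sum_left inner_sum_right b' if_distrib[of "\<lambda>x. _ * x"] power2_eq_square ac_simps cong: if_cong)
  qed
  ultimately show ?thesis by (rule that)
qed

section \<open>Lebesgue measure under orthogonal maps\<close>

lemma nn_integral_lborel_translate:
  fixes c :: "'a::euclidean_space"
  assumes "f \<in> borel_measurable borel"
  shows "(\<integral>\<^sup>+x. f (x + c) \<partial>lborel) = (\<integral>\<^sup>+x. f x \<partial>lborel)"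
proof -
  have "(\<integral>\<^sup>+x. f x \<partial>lborel) = (\<integral>\<^sup>+x. f x \<partial>distr lborel borel ((+) c))"
    by (simp add: lborel_distr_plus)
  also have "\<dots> = (\<integral>\<^sup>+x. f (c + x) \<partial>lborel)"
    using assms by (subst nn_integral_distr) auto
  finally show ?thesis by (simp add: add.commute)
qed

lemma nn_integral_lborel_minus_left:
  fixes c :: "'a::euclidean_space"
  assumes f[measurable]: "f \<in> borel_measurable borel"
  shows "(\<integral>\<^sup>+x. f (c - x) \<partial>lborel) = (\<integral>\<^sup>+x. f x \<partial>lborel)"
proof -
  have "lborel = distr lborel borel (\<lambda>x. c - x)"
    using lborel_affine[of "-1" c] by (simp add: density_1)
  then have "(\<integral>\<^sup>+x. f x \<partial>lborel) = (\<integral>\<^sup>+x. f x \<partial>distr lborel borel (\<lambda>x. c - x))"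
    by simp
  also have "\<dots> = (\<integral>\<^sup>+x. f (c - x) \<partial>lborel)"
    by (subst nn_integral_distr) auto
  finally show ?thesis ..
qed

text \<open>
  The image measure \<open>\<nu>\<close> of Lebesgue measure under \<open>T\<close> is again translation invariant.  Two such measures
  are proportional: by Fubini and the invariance of each factor,
  \<open>\<nu>(A) \<lambda>(B) = \<lambda>(A) \<nu>(B)\<close> for all Borel sets \<open>A\<close> and \<open>B\<close>.  The unit ball \<open>B\<close> is mapped onto itself, so the
  factor is 1.
\<close>

lemma distr_lborel_orthogonal_transformation:
  fixes T :: "'a::euclidean_space \<Rightarrow> 'a"
  assumes T: "orthogonal_transformation T"
  shows "distr lborel borel T = lborel"
proof (rule measure_eqI)
  have lin: "linear T" and T_norm: "\<And>x. norm (T x) = norm x"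
    using T by (auto simp: orthogonal_transformation)
  have [measurable]: "T \<in> borel_measurable borel"
    by (intro borel_measurable_continuous_onI linear_continuous_on lin
        linear_conv_bounded_linear[THEN iffD1])
  define \<nu> where "\<nu> = distr lborel borel T"
  have nu: "(\<integral>\<^sup>+x. h x \<partial>\<nu>) = (\<integral>\<^sup>+x. h (T x) \<partial>lborel)" if [measurable]: "h \<in> borel_measurable borel" for h
    unfolding \<nu>_def by (subst nn_integral_distr) auto
  have nu_translate: "(\<integral>\<^sup>+x. h (x + y) \<partial>\<nu>) = (\<integral>\<^sup>+x. h x \<partial>\<nu>)"
    if [measurable]: "h \<in> borel_measurable borel" for h :: "'a \<Rightarrow> ennreal" and y
  proof -
    obtain z where z: "y = T z"
      using orthogonal_transformation_surj[OF T] by (auto simp: surj_def)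
    have "(\<integral>\<^sup>+x. h (x + y) \<partial>\<nu>) = (\<integral>\<^sup>+x. h (T (x + z)) \<partial>lborel)"
      by (simp add: nu z linear_add[OF lin])
    also have "\<dots> = (\<integral>\<^sup>+x. h x \<partial>\<nu>)"
      by (subst nn_integral_lborel_translate) (simp_all add: nu)
    finally show ?thesis .
  qed
  define B where "B = ball (0::'a) 1"
  have [measurable]: "B \<in> sets borel" by (simp add: B_def)
  have nuB: "emeasure \<nu> B = emeasure lborel B"
  proof -
    have "T -` B = B" by (auto simp: B_def T_norm)
    then show ?thesis unfolding \<nu>_def by (simp add: emeasure_distr)
  qed
  have Bpos: "emeasure lborel B \<noteq> 0" "emeasure lborel B \<noteq> \<infinity>"
    using content_ball_pos[of 1 "0::'a"] emeasure_lborel_ball_finite[of "0::'a" 1]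
    by (auto simp: B_def measure_def)
  have sets_nu [measurable_cong]: "sets \<nu> = sets borel" by (simp add: \<nu>_def)
  interpret L: sigma_finite_measure "lborel :: 'a measure" by (rule sigma_finite_lborel)
  interpret N: sigma_finite_measure \<nu>
  proof
    have "emeasure \<nu> (ball 0 (real n)) \<noteq> \<infinity>" for n
    proof -
      have "T -` ball 0 (real n) = ball 0 (real n)" by (auto simp: T_norm)
      then show ?thesis
        using emeasure_lborel_ball_finite[of "0::'a" "real n"] by (simp add: \<nu>_def emeasure_distr)
    qed
    moreover have "(\<Union>n. ball (0::'a) (real n)) = UNIV"
      using reals_Archimedean2 by fastforce
    ultimately show "\<exists>A. countable A \<and> A \<subseteq> sets \<nu> \<and> \<Union> A = space \<nu> \<and> (\<forall>a\<in>A. emeasure \<nu> a \<noteq> \<infinity>)"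
      by (intro exI[of _ "range (\<lambda>n. ball 0 (real n))"]) (auto simp: \<nu>_def)
  qed
  interpret pair_sigma_finite \<nu> "lborel :: 'a measure" ..
  fix A assume "A \<in> sets (distr lborel borel T)"
  then have [measurable]: "A \<in> sets borel" by simp
  have "emeasure \<nu> A * emeasure lborel B = (\<integral>\<^sup>+x. indicator A x * emeasure lborel B \<partial>\<nu>)"
    by (simp add: nn_integral_multc)
  also have "\<dots> = (\<integral>\<^sup>+x. (\<integral>\<^sup>+y. indicator A x * indicator B y \<partial>lborel) \<partial>\<nu>)"
    by (simp add: nn_integral_cmult)
  also have "\<dots> = (\<integral>\<^sup>+x. (\<integral>\<^sup>+y. indicator A x * indicator B (y + x) \<partial>lborel) \<partial>\<nu>)"
    by (subst nn_integral_lborel_translate) simp_all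
  also have "\<dots> = (\<integral>\<^sup>+y. (\<integral>\<^sup>+x. indicator A x * indicator B (y + x) \<partial>\<nu>) \<partial>lborel)"
    by (rule Fubini'[symmetric]) simp
  also have "\<dots> = (\<integral>\<^sup>+y. (\<integral>\<^sup>+x. indicator A (x - y) * indicator B x \<partial>\<nu>) \<partial>lborel)"
  proof (rule nn_integral_cong)
    fix y :: 'a
    show "(\<integral>\<^sup>+x. indicator A x * indicator B (y + x) \<partial>\<nu>) = (\<integral>\<^sup>+x. indicator A (x - y) * indicator B x \<partial>\<nu>)"
      using nu_translate[of "\<lambda>x. indicator A (x - y) * indicator B x" y] by (simp add: add.commute)
  qed
  also have "\<dots> = (\<integral>\<^sup>+x. (\<integral>\<^sup>+y. indicator A (x - y) * indicator B x \<partial>lborel) \<partial>\<nu>)"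
    by (rule Fubini') simp
  also have "\<dots> = (\<integral>\<^sup>+x. emeasure lborel A * indicator B x \<partial>\<nu>)"
    by (subst nn_integral_multc) (simp_all add: nn_integral_lborel_minus_left[of "indicator A"])
  also have "\<dots> = emeasure lborel A * emeasure lborel B"
    by (simp add: nn_integral_cmult nuB)
  finally have "emeasure \<nu> A = emeasure lborel A"
    using Bpos by (metis ennreal_mult_divide_eq infinity_ennreal_def)
  then show "emeasure (distr lborel borel T) A = emeasure lborel A"
    by (simp add: \<nu>_def)
qed simp

section \<open>Rotation invariance of the standard normal vector\<close>

lemma PiM_density_lborel:
  fixes h :: "real \<Rightarrow> ennreal"
  assumes [measurable]: "h \<in> borel_measurable borel" and fin: "sigma_finite_measure (density lborel h)"
  shows "Pi\<^sub>M (UNIV :: 'n::finite set) (\<lambda>_. density lborel h) =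
    density (Pi\<^sub>M UNIV (\<lambda>_. lborel)) (\<lambda>x. \<Prod>i\<in>UNIV. h (x i))"
proof -
  interpret D: sigma_finite_measure "density lborel h" by fact
  interpret L: product_sigma_finite "\<lambda>_::'n. lborel :: real measure" ..
  interpret P: product_sigma_finite "\<lambda>_::'n. density lborel h" ..
  show ?thesis
  proof (rule P.PiM_eqI[symmetric])
    show "sets (density (Pi\<^sub>M UNIV (\<lambda>_. lborel)) (\<lambda>x. \<Prod>i\<in>UNIV. h (x i))) =
      sets (Pi\<^sub>M (UNIV::'n set) (\<lambda>_. density lborel h))"
      by (simp cong: sets_PiM_cong)
    fix A :: "'n \<Rightarrow> real set"
    assume "\<And>i. i \<in> UNIV \<Longrightarrow> A i \<in> sets (density lborel h)"
    then have [measurable]: "\<And>i. A i \<in> sets borel" by simp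
    have "emeasure (density (Pi\<^sub>M UNIV (\<lambda>_. lborel)) (\<lambda>x. \<Prod>i\<in>UNIV. h (x i))) (Pi\<^sub>E UNIV A)
      = (\<integral>\<^sup>+x. (\<Prod>i\<in>UNIV. h (x i) * indicator (A i) (x i)) \<partial>Pi\<^sub>M UNIV (\<lambda>_. lborel))"
    proof -
      have "(\<Prod>i\<in>UNIV. indicator (A i) (x i)) = (indicator (Pi\<^sub>E UNIV A) x :: ennreal)" for x
        by (cases "\<forall>i. x i \<in> A i") (auto simp: indicator_def prod_zero_iff PiE_iff)
      then show ?thesis
        by (subst emeasure_density) (auto simp: prod.distrib)
    qed
    also have "\<dots> = (\<Prod>i\<in>UNIV. emeasure (density lborel h) (A i))"
      by (subst L.product_nn_integral_prod) (auto simp: emeasure_density)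
    finally show "emeasure (density (Pi\<^sub>M UNIV (\<lambda>_. lborel)) (\<lambda>x. \<Prod>i\<in>UNIV. h (x i))) (Pi\<^sub>E UNIV A)
      = (\<Prod>i\<in>UNIV. emeasure (density lborel h) (A i))" .
  qed simp
qed

lemma measurable_vec_lambda [measurable]:
  "(\<lambda>z. \<chi> i. z i) \<in> Pi\<^sub>M (UNIV :: 'n::finite set) (\<lambda>_. borel) \<rightarrow>\<^sub>M (borel :: (real ^ 'n) measure)"
  by (subst borel_measurable_euclidean_space) (auto simp: Basis_vec_def inner_axis)

lemma lborel_vec_eq_distr_PiM:
  "(lborel :: (real ^ 'n) measure) = distr (Pi\<^sub>M UNIV (\<lambda>_. lborel)) borel (\<lambda>z. \<chi> i. z i)"
proof (rule lborel_eqI)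
  interpret L: product_sigma_finite "\<lambda>_::'n. lborel :: real measure" ..
  fix l u :: "real ^ 'n"
  assume "\<And>b. b \<in> Basis \<Longrightarrow> l \<bullet> b \<le> u \<bullet> b"
  then have le: "l $ i \<le> u $ i" for i
    by (metis axis_in_Basis_iff cart_eq_inner_axis Basis_real_def insertI1)
  have "emeasure (distr (Pi\<^sub>M UNIV (\<lambda>_. lborel)) borel (\<lambda>z. \<chi> i. z i)) (box l u)
    = emeasure (Pi\<^sub>M UNIV (\<lambda>_. lborel)) (Pi\<^sub>E UNIV (\<lambda>i::'n. {l $ i<..<u $ i}))"
    by (subst emeasure_distr) (auto simp: space_PiM mem_box_cart PiE_iff intro!: arg_cong2[where f = emeasure])
  also have "\<dots> = (\<Prod>i\<in>UNIV. ennreal (u $ i - l $ i))"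
    by (subst L.emeasure_PiM) (auto simp: le)
  also have "\<dots> = ennreal (\<Prod>i\<in>UNIV. u $ i - l $ i)"
    by (subst prod_ennreal) (auto simp: le)
  also have "(\<Prod>i\<in>UNIV. u $ i - l $ i) = (\<Prod>b\<in>Basis. (u - l) \<bullet> b)"
    by (subst prod.reindex_cong[of "\<lambda>i. axis i 1" UNIV])
      (auto simp: Basis_vec_def inj_on_def axis_eq_axis inner_axis)
  finally show "emeasure (distr (Pi\<^sub>M UNIV (\<lambda>_. lborel)) borel (\<lambda>z. \<chi> i. z i)) (box l u) =
    ennreal (\<Prod>b\<in>Basis. (u - l) \<bullet> b)" .
qed simp

text \<open>
  The product of the marginal densities depends on \<open>x\<close> only through its Euclidean norm, which makes the
  rotation invariance visible.
\<close>

lemma std_normal_vec_eq_density: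
  "(std_normal_vec :: (real ^ 'n) measure) =
    density lborel (\<lambda>x. ennreal ((1 / sqrt (2 * pi)) ^ CARD('n) * exp (- (norm x)\<^sup>2 / 2)))"
proof -
  interpret N: prob_space "density lborel (\<lambda>t. ennreal (std_normal_density t))"
    by (rule prob_space_normal_density) simp
  have [measurable]: "(\<lambda>z. \<chi> i. z i) \<in> Pi\<^sub>M (UNIV :: 'n set) (\<lambda>_. lborel) \<rightarrow>\<^sub>M (borel :: (real ^ 'n) measure)"
    by simp
  have "(\<Prod>i\<in>UNIV. ennreal (std_normal_density (x $ i))) =
      ennreal ((1 / sqrt (2 * pi)) ^ CARD('n) * exp (- (norm x)\<^sup>2 / 2))" for x :: "real ^ 'n"
  proof -
    have "(\<Prod>i\<in>UNIV. std_normal_density (x $ i)) =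
        (1 / sqrt (2 * pi)) ^ CARD('n) * exp (\<Sum>i\<in>UNIV. - (x $ i)\<^sup>2 / 2)"
      by (simp add: std_normal_density_def prod_dividef power_divide exp_sum)
    also have "(\<Sum>i\<in>UNIV. - (x $ i)\<^sup>2 / 2) = - (norm x)\<^sup>2 / 2"
      by (simp add: norm_vec_def L2_set_def sum_nonneg sum_negf sum_divide_distrib)
    finally show ?thesis
      by (subst prod_ennreal) auto
  qed
  then have "density lborel (\<lambda>x::real^'n. ennreal ((1 / sqrt (2 * pi)) ^ CARD('n) * exp (- (norm x)\<^sup>2 / 2)))
     = density lborel (\<lambda>x. \<Prod>i\<in>UNIV. ennreal (std_normal_density (x $ i)))"
    by simp
  also have "\<dots> = std_normal_vec"
    unfolding std_normal_vec_def
    by (subst PiM_density_lborel, simp, rule N.sigma_finite_measure_axioms)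
       (subst lborel_vec_eq_distr_PiM, subst density_distr, simp_all)
  finally show ?thesis ..
qed

lemma std_normal_vec_rotation_invariant:
  fixes U :: "real ^ 'n ^ 'n"
  assumes "orthogonal_matrix U"
  shows "distr std_normal_vec borel ((*v) U) = std_normal_vec"
proof -
  have U: "orthogonal_transformation ((*v) U)"
    using assms by (simp add: orthogonal_transformation_matrix)
  have [measurable]: "(*v) U \<in> borel_measurable borel"
    by (intro borel_measurable_continuous_onI linear_continuous_on matrix_vector_mul_bounded_linear)
  let ?h = "\<lambda>x. ennreal ((1 / sqrt (2 * pi)) ^ CARD('n) * exp (- (norm x)\<^sup>2 / 2))"
  have "std_normal_vec = density (distr lborel borel ((*v) U)) ?h"
    by (simp add: std_normal_vec_eq_density distr_lborel_orthogonal_transformation[OF U])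
  also have "\<dots> = distr (density lborel (\<lambda>x. ?h (U *v x))) borel ((*v) U)"
    by (rule density_distr) simp_all
  also have "\<dots> = distr std_normal_vec borel ((*v) U)"
    using orthogonal_transformation_norm[OF U] by (simp add: std_normal_vec_eq_density)
  finally show ?thesis ..
qed

section \<open>Laws of Gaussian quadratic forms\<close>

lemma sets_std_normal_vec [measurable_cong]: "sets std_normal_vec = sets borel"
  by (simp add: std_normal_vec_def)

lemma prob_space_std_normal_vec: "prob_space std_normal_vec"
  unfolding std_normal_vec_def
  by (intro prob_space.prob_space_distr prob_space_PiM prob_space_normal_density) simp_all

lemma borel_measurable_matrix_vector_mult [measurable]:
  "(*v) (A :: real ^ 'n ^ 'm) \<in> borel_measurable borel"
  by (intro borel_measurable_continuous_onI linear_continuous_on matrix_vector_mul_bounded_linear)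

text \<open>
  Substituting \<open>z = U y\<close> with \<open>U\<close> diagonalising \<open>C\<close> does not change the law of the argument.
\<close>

lemma distr_quadratic_form_std_normal_vec:
  fixes C :: "real ^ 'n ^ 'n"
  assumes "transpose C = C" and "lists_eigenvalues c C"
  shows "distr std_normal_vec borel (\<lambda>z. z \<bullet> (C *v z)) =
    distr std_normal_vec borel (\<lambda>z. \<Sum>i\<in>UNIV. c i * (z $ i)\<^sup>2)"
proof -
  obtain U where U: "orthogonal_matrix U"
    and diag: "\<And>y. (U *v y) \<bullet> (C *v (U *v y)) = (\<Sum>i\<in>UNIV. c i * (y $ i)\<^sup>2)"
    using diagonalise_with_listed_eigenvalues[OF assms] by blast
  have "distr std_normal_vec borel (\<lambda>z. z \<bullet> (C *v z)) =
      distr (distr std_normal_vec borel ((*v) U)) borel (\<lambda>z. z \<bullet> (C *v z))"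
    by (simp add: std_normal_vec_rotation_invariant[OF U])
  also have "\<dots> = distr std_normal_vec borel (\<lambda>y. (U *v y) \<bullet> (C *v (U *v y)))"
    by (subst distr_distr) (simp_all add: comp_def)
  finally show ?thesis by (simp add: diag)
qed

lemma distr_indep_std_normal_eq_std_normal_vec:
  fixes Z :: "'n::finite \<Rightarrow> 'z \<Rightarrow> real"
  assumes "prob_space P" and indep: "prob_space.indep_vars P (\<lambda>_. borel) Z UNIV"
    and Z: "\<And>i. distributed P lborel (Z i) (\<lambda>t. ennreal (std_normal_density t))"
  shows "distr P borel (\<lambda>\<omega>. \<chi> i. Z i \<omega>) = std_normal_vec"
proof -
  interpret prob_space P by fact
  have meas [measurable]: "Z i \<in> borel_measurable P" for i
    using distributed_measurable[OF Z[of i]] by simp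
  have Zi: "distr P borel (Z i) = density lborel (\<lambda>t. ennreal (std_normal_density t))" for i
    using distributed_distr_eq_density[OF Z[of i]] by (simp cong: distr_cong)
  have joint: "distr P (Pi\<^sub>M UNIV (\<lambda>_. borel)) (\<lambda>\<omega>. \<lambda>i\<in>UNIV. Z i \<omega>) =
    Pi\<^sub>M UNIV (\<lambda>_. density lborel (\<lambda>t. ennreal (std_normal_density t)))"
    using indep by (subst (asm) indep_vars_iff_distr_eq_PiM') (simp_all add: Zi)
  show ?thesis
    unfolding std_normal_vec_def joint[symmetric]
    by (subst distr_distr) (simp_all add: comp_def, simp add: restrict_def)
qed

section \<open>Symmetry of the asymptotic covariance matrix\<close>

lemma matrix_inv_symmetric:
  fixes A :: "real ^ 'n ^ 'n"
  assumes "invertible A" and sym: "transpose A = A"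
  shows "transpose (matrix_inv A) = matrix_inv A"
proof -
  have inv: "A ** matrix_inv A = mat 1" "matrix_inv A ** A = mat 1"
    using someI_ex[OF assms(1)[unfolded invertible_def]] unfolding matrix_inv_def by blast+
  have "transpose (matrix_inv A) ** A = mat 1"
    using arg_cong[OF inv(1), of transpose] by (simp add: matrix_transpose_mul sym transpose_mat)
  then show ?thesis
    by (metis inv(1) matrix_mul_assoc matrix_mul_lid matrix_mul_rid)
qed

lemma transpose_outer: "transpose (outer v) = outer v"
  by (simp add: outer_def transpose_def vec_eq_iff mult.commute)

lemma bounded_linear_transpose: "bounded_linear (transpose :: real ^ 'n ^ 'n \<Rightarrow> real ^ 'n ^ 'n)"
  by (intro linear_conv_bounded_linear[THEN iffD1] linearI) (simp_all add: transpose_def vec_eq_iff)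

text \<open>
  This holds for every integrand: transposition is an involution, so it preserves and reflects
  integrability, and a non-integrable integrand has integral 0 on both sides.
\<close>

lemma transpose_integral_outer:
  "transpose (\<integral>x. h x *\<^sub>R outer (v x) \<partial>M) = (\<integral>x. h x *\<^sub>R outer (v x) \<partial>M :: real ^ 'n ^ 'n)"
proof -
  have "transpose (\<integral>x. h x *\<^sub>R outer (v x) \<partial>M) = (\<integral>x. transpose (h x *\<^sub>R outer (v x)) \<partial>M)"
    by (rule integral_bounded_linear'[symmetric, OF bounded_linear_transpose bounded_linear_transpose]) simp
  then show ?thesis
    by (simp add: transpose_scalar transpose_outer)
qed

lemma Sigma_mat_symmetric:
  assumes "invertible (J_mat \<mu> f \<beta> \<theta>)"
  shows "transpose (Sigma_mat \<mu> f \<beta> \<theta>) = Sigma_mat \<mu> f \<beta> \<theta>"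
proof -
  have "transpose (J_mat \<mu> f \<beta> \<theta>) = J_mat \<mu> f \<beta> \<theta>"
    by (simp add: J_mat_def transpose_integral_outer)
  moreover have "transpose (K_mat \<mu> f \<beta> \<theta>) = K_mat \<mu> f \<beta> \<theta>"
    by (simp add: K_mat_def linear_diff[OF bounded_linear.linear[OF bounded_linear_transpose]]
        transpose_integral_outer transpose_outer)
  ultimately show ?thesis
    by (simp add: Sigma_mat_def matrix_transpose_mul matrix_inv_symmetric[OF assms] matrix_mul_assoc)
qed

section \<open>Convergence of the Wald-type statistic\<close>

lemma weak_conv_vec_continuous_mapping:
  fixes q :: "real ^ 'n \<Rightarrow> real"
  assumes M: "prob_space M" and N_prob: "prob_space N"
    and conv: "weak_conv_vec (\<lambda>n. distr M borel (Y n)) N"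
    and Y [measurable]: "\<And>n. Y n \<in> borel_measurable M"
    and N [measurable_cong]: "sets N = sets borel"
    and q: "continuous_on UNIV q"
  shows "weak_conv_m (\<lambda>n. distr M borel (\<lambda>\<omega>. q (Y n \<omega>))) (distr N borel q)"
proof (rule integral_bdd_continuous_conv_imp_weak_conv)
  have [measurable]: "q \<in> borel_measurable borel"
    using q by (rule borel_measurable_continuous_onI)
  show "real_distribution (distr M borel (\<lambda>\<omega>. q (Y n \<omega>)))" for n
    by (rule prob_space.real_distribution_distr[OF M]) simp
  show "real_distribution (distr N borel q)"
    by (rule prob_space.real_distribution_distr[OF N_prob]) simp
  fix h :: "real \<Rightarrow> real"
  assume h: "\<And>x. isCont h x" "\<And>x. \<bar>h x\<bar> \<le> 1"
  then have hc: "continuous_on UNIV h"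
    by (simp add: continuous_at_imp_continuous_on)
  then have [measurable]: "h \<in> borel_measurable borel"
    by (rule borel_measurable_continuous_onI)
  have "continuous_on UNIV (\<lambda>x. h (q x))"
    by (rule continuous_on_compose2[OF hc q]) simp
  moreover have "bounded (range (\<lambda>x. h (q x)))"
    using h(2) by (auto simp: bounded_iff)
  ultimately have "(\<lambda>n. \<integral>x. h (q x) \<partial>distr M borel (Y n)) \<longlonglongrightarrow> (\<integral>x. h (q x) \<partial>N)"
    using conv unfolding weak_conv_vec_def by blast
  then show "(\<lambda>n. integral\<^sup>L (distr M borel (\<lambda>\<omega>. q (Y n \<omega>))) h) \<longlonglongrightarrow> integral\<^sup>L (distr N borel q) h"
    by (simp add: integral_distr)
qed

theorem theorem9:
  fixes \<mu> :: "'x measure"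
    and f :: "real ^ 'p \<Rightarrow> 'x \<Rightarrow> real"
    and \<Theta> :: "(real ^ 'p) set"
    and \<beta> :: real
    and g :: "'x \<Rightarrow> real"
    and M :: "'w measure"
    and X :: "nat \<Rightarrow> 'w \<Rightarrow> 'x"
    and \<theta>hat :: "nat \<Rightarrow> 'w \<Rightarrow> real ^ 'p"
    and \<theta>0 :: "real ^ 'p"
    and P :: "'z measure"
    and Z :: "'p \<Rightarrow> 'z \<Rightarrow> real"
  assumes model: "\<And>\<theta>. \<theta> \<in> \<Theta> \<Longrightarrow> is_density \<mu> (f \<theta>)"
    and beta: "0 \<le> \<beta>"
    and g: "is_density \<mu> g"
    and M: "prob_space M"
    and X_indep: "prob_space.indep_vars M (\<lambda>_. \<mu>) X UNIV"
    and X_dist: "\<And>i. distributed M \<mu> (X i) (\<lambda>x. ennreal (g x))"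
    and estimator: "is_mdpd_estimator \<mu> f \<Theta> \<beta> M X \<theta>hat"
    and J_inv: "invertible (J_mat \<mu> f \<beta> \<theta>0)"
    and J_g_inv: "invertible (J_mat_g \<mu> f g \<beta> \<theta>0)"
    and Sigma_inv: "invertible (Sigma_mat \<mu> f \<beta> \<theta>0)"
    and standing_fact:
      "mdpd_functional \<mu> f \<Theta> \<beta> (density \<mu> (\<lambda>x. ennreal (g x))) = {\<theta>0} \<Longrightarrow>
       \<exists>N. multivariate_normal 0 (Sigma_mat_g \<mu> f g \<beta> \<theta>0) N \<and>
           weak_conv_vec (\<lambda>n. distr M borel (\<lambda>\<omega>. sqrt (real n) *\<^sub>R (\<theta>hat n \<omega> - \<theta>0))) N"
    and H0: "mdpd_functional \<mu> f \<Theta> \<beta> (density \<mu> (\<lambda>x. ennreal (g x))) = {\<theta>0}"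
    and P: "prob_space P"
    and Z_indep: "prob_space.indep_vars P (\<lambda>_. borel) Z UNIV"
    and Z_dist: "\<And>i. distributed P lborel (Z i) (\<lambda>t. ennreal (std_normal_density t))"
  defines "A \<equiv> matrix_inv (Sigma_mat \<mu> f \<beta> \<theta>0) ** Sigma_mat_g \<mu> f g \<beta> \<theta>0"
  shows "(\<exists>c. lists_eigenvalues c A) \<and>
    (\<forall>c. lists_eigenvalues c A \<longrightarrow>
      weak_conv_m
        (\<lambda>n. distr M borel (\<lambda>\<omega>.
           real n * ((\<theta>hat n \<omega> - \<theta>0) \<bullet> (matrix_inv (Sigma_mat \<mu> f \<beta> \<theta>0) *v (\<theta>hat n \<omega> - \<theta>0)))))
        (distr P borel (\<lambda>\<omega>. \<Sum>i\<in>UNIV. c i * (Z i \<omega>)\<^sup>2)))"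
proof -
  define Q where "Q = matrix_inv (Sigma_mat \<mu> f \<beta> \<theta>0)"
  have Q_sym: "transpose Q = Q"
    unfolding Q_def by (intro matrix_inv_symmetric Sigma_inv Sigma_mat_symmetric J_inv)
  define Y where "Y n \<omega> = sqrt (real n) *\<^sub>R (\<theta>hat n \<omega> - \<theta>0)" for n \<omega>
  define q where "q x = x \<bullet> (Q *v x)" for x
  obtain B :: "real ^ 'p ^ 'p" and N where B: "B ** transpose B = Sigma_mat_g \<mu> f g \<beta> \<theta>0"
    and N: "N = distr std_normal_vec borel ((*v) B)"
    and conv: "weak_conv_vec (\<lambda>n. distr M borel (Y n)) N"
    using standing_fact[OF H0] unfolding multivariate_normal_def Y_def[abs_def] by auto
  have N_prob: "prob_space N"
    unfolding N by (rule prob_space.prob_space_distr[OF prob_space_std_normal_vec]) simp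
  define C where "C = transpose B ** (Q ** B)"
  have C_sym: "transpose C = C"
    by (simp add: C_def matrix_transpose_mul Q_sym matrix_mul_assoc)
  have "A = (Q ** B) ** transpose B"
    by (simp add: A_def Q_def matrix_mul_assoc flip: B)
  then have "charpoly A = charpoly C"
    unfolding C_def by (simp only: charpoly_matrix_mult_commute)
  then have eig: "lists_eigenvalues c A \<longleftrightarrow> lists_eigenvalues c C" for c
    by (simp add: lists_eigenvalues_def)

  \<comment> \<open>\<open>\<theta>hat 0\<close> may fail to be measurable, but \<open>Y 0\<close> is constantly 0 because of the factor \<open>sqrt 0\<close>.\<close>
  have Y_meas: "Y n \<in> borel_measurable M" for n
  proof (cases "n = 0")
    case False
    then have [measurable]: "\<theta>hat n \<in> borel_measurable M"
      using estimator unfolding is_mdpd_estimator_def by blast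
    show ?thesis unfolding Y_def[abs_def] by measurable
  qed (simp add: Y_def[abs_def])
  have q_cont: "continuous_on UNIV q"
    unfolding q_def[abs_def]
    by (intro continuous_intros linear_continuous_on matrix_vector_mul_bounded_linear)
  have W: "q (Y n \<omega>) = real n * ((\<theta>hat n \<omega> - \<theta>0) \<bullet> (Q *v (\<theta>hat n \<omega> - \<theta>0)))" for n \<omega>
    by (simp add: q_def Y_def matrix_vector_mult_scaleR mult.assoc[symmetric])
  have "q (B *v z) = z \<bullet> (C *v z)" for z
  proof -
    have "(B *v z) \<bullet> w = z \<bullet> (transpose B *v w)" for w
      by (metis dot_lmul_matrix vector_transpose_matrix)
    then have "q (B *v z) = z \<bullet> (transpose B *v (Q *v (B *v z)))"
      unfolding q_def .
    also have "\<dots> = z \<bullet> (C *v z)"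
      unfolding C_def matrix_vector_mul_assoc ..
    finally show ?thesis .
  qed
  then have qN: "distr N borel q = distr std_normal_vec borel (\<lambda>z. z \<bullet> (C *v z))"
    unfolding N using borel_measurable_continuous_onI[OF q_cont]
    by (subst distr_distr) (simp_all add: comp_def)
  have "weak_conv_m (\<lambda>n. distr M borel (\<lambda>\<omega>. q (Y n \<omega>)))
      (distr P borel (\<lambda>\<omega>. \<Sum>i\<in>UNIV. c i * (Z i \<omega>)\<^sup>2))" if "lists_eigenvalues c A" for c
  proof -
    have [measurable]: "Z i \<in> borel_measurable P" for i
      using distributed_measurable[OF Z_dist[of i]] by simp
    have [measurable]: "(\<lambda>\<omega>. \<chi> i. Z i \<omega>) \<in> borel_measurable P"
      by (subst borel_measurable_euclidean_space) (auto simp: Basis_vec_def inner_axis)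
    have "distr N borel q = distr std_normal_vec borel (\<lambda>z. \<Sum>i\<in>UNIV. c i * (z $ i)\<^sup>2)"
      unfolding qN using C_sym that eig by (intro distr_quadratic_form_std_normal_vec) auto
    also have "\<dots> = distr P borel (\<lambda>\<omega>. \<Sum>i\<in>UNIV. c i * (Z i \<omega>)\<^sup>2)"
      unfolding distr_indep_std_normal_eq_std_normal_vec[OF P Z_indep Z_dist, symmetric]
      by (subst distr_distr) (simp_all add: comp_def)
    finally have limit: "distr N borel q = distr P borel (\<lambda>\<omega>. \<Sum>i\<in>UNIV. c i * (Z i \<omega>)\<^sup>2)" .
    have "sets N = sets borel"
      by (simp add: N)
    from weak_conv_vec_continuous_mapping[OF M N_prob conv Y_meas this q_cont]
    show ?thesis
      unfolding limit .
  qed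
  moreover have "\<exists>c. lists_eigenvalues c A"
    unfolding eig by (rule symmetric_matrix_eigenbasis[OF C_sym]) (rule exI)
  ultimately show ?thesis
    unfolding W Q_def by (intro conjI allI impI)
qed

end
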